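(* Let $x\in\overline{\mathbb K}_f$. Then $x$ is a unit of $\overline{\mathbb K}_f$ if and only if there are $r>0$, a function $\tau:\mathcal A_0\to]0,1]$ and a representative $\hat x$ of $x$ such that $|\hat x(\varphi_\varepsilon)|\ge i(\varphi_\varepsilon)^r$ for all $\varphi\in\mathcal A_0$ and all $0<\varepsilon<\tau(\varphi)$.
   Context: $\mathbb K$ is $\mathbb R$ or $\mathbb C$, $I=]0,1]$, $\mathbb N=\{0,1,2,\dots\}$. $\mathcal A_0$ is the set of real-valued $\varphi\in C_c^\infty(\mathbb R)$ that are even, constant in a neighbourhood of $0$, and satisfy $\int_0^\infty\varphi(x)\,dx=\tfrac12$. For $q\in\mathbb N$, $\mathcal A_q=\{\varphi\in\mathcal A_0:\int_0^\infty x^{j/m}\varphi(x)\,dx=0\text{ for all integers }1\le j,m\le q\}$. For $\varepsilon\in I$, $\varphi_\varepsilon(x)=\varepsilon^{-1}\varphi(x/\varepsilon)$. $\Gamma$ is the set of strictly increasing $\gamma:\mathbb N\to[0,\infty)$ with $\gamma(n)\to\infty$. $i(\varphi)=\mathrm{diam}(\mathrm{supp}\,\varphi)$, so $i(\varphi_\varepsilon)=\varepsilon\, i(\varphi)$. $\mathcal E_f^M(\mathbb K)$ is the ring (pointwise operations) of functions $v:\mathcal A_0\to\mathbb K$ such that there is $p\in\mathbb N$ such that for all $\varphi\in\mathcal A_p$ there are $C,\eta>0$ with $|v(\varphi_\varepsilon)|\le C\varepsilon^{-p}$ for all $\varepsilon\in I$, $\varepsilon<\eta$. $\mathcal N_f(\mathbb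 K)$ is the ideal of those $v\in\mathcal E_f^M(\mathbb K)$ for which there are $p\in\mathbb N$, $\gamma\in\Gamma$ such that for all $q\ge p$ and $\varphi\in\mathcal A_q$ there are $C,\eta>0$ with $|v(\varphi_\varepsilon)|\le C\varepsilon^{\gamma(q)-p}$ for all $\varepsilon\in I$, $\varepsilon<\eta$. $\overline{\mathbb K}_f=\mathcal E_f^M(\mathbb K)/\mathcal N_f(\mathbb K)$; a representative of $x\in\overline{\mathbb K}_f$ is any $\hat x\in\mathcal E_f^M(\mathbb K)$ in the class $x$. *)

theory Defs
  imports "HOL-Analysis.Analysis" "HOL-Algebra.QuotRing"
begin

definition supp :: "(real \<Rightarrow> real) \<Rightarrow> real set"
  where "supp \<phi> = closure {x. \<phi> x \<noteq> 0}"

definition Cc_infinity :: "(real \<Rightarrow> real) set"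
  where "Cc_infinity = {\<phi>. (\<forall>n. (deriv ^^ n) \<phi> differentiable_on UNIV) \<and> compact (supp \<phi>)}"

definition A0 :: "(real \<Rightarrow> real) set"
  where "A0 = {\<phi> \<in> Cc_infinity.
    (\<forall>x. \<phi> (- x) = \<phi> x) \<and>
    (\<exists>c. \<forall>\<^sub>F x in nhds 0. \<phi> x = c) \<and>
    (LBINT x:{0..}. \<phi> x) = 1 / 2}"

definition A :: "nat \<Rightarrow> (real \<Rightarrow> real) set"
  where "A q = {\<phi> \<in> A0. \<forall>j\<in>{1..q}. \<forall>m\<in>{1..q}.
    (LBINT x:{0..}. x powr (real j / real m) * \<phi> x) = 0}"

text \<open>
  \<open>rescale \<epsilon> \<phi>\<close> is the function usually written \<open>\<phi>\<^sub>\<epsilon>\<close>; it is only used for \<open>\<epsilon> > 0\<close>.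
\<close>

definition rescale :: "real \<Rightarrow> (real \<Rightarrow> real) \<Rightarrow> real \<Rightarrow> real"
  where "rescale \<epsilon> \<phi> = (\<lambda>x. inverse \<epsilon> * \<phi> (x / \<epsilon>))"

definition diam_supp :: "(real \<Rightarrow> real) \<Rightarrow> real"
  where "diam_supp \<phi> = diameter (supp \<phi>)"

definition Gam :: "(nat \<Rightarrow> real) set"
  where "Gam = {\<gamma>. strict_mono \<gamma> \<and> (\<forall>n. 0 \<le> \<gamma> n) \<and> filterlim \<gamma> at_top sequentially}"

text \<open>
  Functions with domain \<open>A0\<close> are represented as extensional functions, so that the equality of
  the ring below is equality of functions on \<open>A0\<close>. The type \<open>'k\<close> of scalars
  is meant to be instantiated with \<open>real\<close> or \<open>complex\<close>.
\<close>

definition power_bounded :: "((real \<Rightarrow> real) \<Rightarrow> 'k::real_normed_field) \<Rightarrow> (real \<Rightarrow> real) \<Rightarrow> real \<Rightarrow> bool"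
  where "power_bounded v \<phi> a \<longleftrightarrow> (\<exists>C>0. \<exists>\<eta>>0.
    \<forall>\<epsilon>\<in>{0<..1}. \<epsilon> < \<eta> \<longrightarrow> norm (v (rescale \<epsilon> \<phi>)) \<le> C * \<epsilon> powr a)"

definition E_M :: "((real \<Rightarrow> real) \<Rightarrow> 'k::real_normed_field) set"
  where "E_M = {v \<in> extensional A0. \<exists>p::nat. \<forall>\<phi>\<in>A p. power_bounded v \<phi> (- real p)}"

definition E_ring :: "((real \<Rightarrow> real) \<Rightarrow> 'k::real_normed_field) ring"
  where "E_ring =
    \<lparr>carrier = E_M,
     monoid.mult = (\<lambda>u v. \<lambda>\<phi>\<in>A0. u \<phi> * v \<phi>),
     one = (\<lambda>\<phi>\<in>A0. 1),
     zero = (\<lambda>\<phi>\<in>A0. 0),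
     add = (\<lambda>u v. \<lambda>\<phi>\<in>A0. u \<phi> + v \<phi>)\<rparr>"

definition N_ideal :: "((real \<Rightarrow> real) \<Rightarrow> 'k::real_normed_field) set"
  where "N_ideal = {v \<in> E_M. \<exists>p::nat. \<exists>\<gamma>\<in>Gam. \<forall>q\<ge>p. \<forall>\<phi>\<in>A q.
    power_bounded v \<phi> (\<gamma> q - real p)}"

lemma rescale_in_A0:
  assumes "\<phi> \<in> A0" "\<epsilon> > 0"
  shows "rescale \<epsilon> \<phi> \<in> A0"
proof -
  have diff: "(deriv ^^ n) \<phi> differentiable_on UNIV" for n
    using assms(1) by (auto simp: A0_def Cc_infinity_def)
  have der: "((\<lambda>x. c * (deriv ^^ n) \<phi> (x / \<epsilon>)) has_real_derivative
      (c / \<epsilon>) * (deriv ^^ Suc n) \<phi> (x / \<epsilon>)) (at x)" for n c x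
  proof -
    have "((deriv ^^ n) \<phi>) field_differentiable (at (x / \<epsilon>))"
      using diff[of n] by (auto simp: differentiable_on_def field_differentiable_def
          real_differentiable_def)
    then have "((deriv ^^ n) \<phi> has_real_derivative (deriv ^^ Suc n) \<phi> (x / \<epsilon>)) (at (x / \<epsilon>))"
      using DERIV_deriv_iff_field_differentiable by auto
    from DERIV_chain2[where f = "(deriv ^^ n) \<phi>" and g = "\<lambda>x. x / \<epsilon>" and x = x and s = UNIV, OF this]
    have "((\<lambda>x. (deriv ^^ n) \<phi> (x / \<epsilon>)) has_real_derivative
        (deriv ^^ Suc n) \<phi> (x / \<epsilon>) * (1 / \<epsilon>)) (at x)"
      using DERIV_cdivide[OF DERIV_ident] by blast
    from DERIV_cmult[OF this, of c] show ?thesis by (simp add: mult_ac)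
  qed
  have iter: "(deriv ^^ n) (rescale \<epsilon> \<phi>) = (\<lambda>x. (1 / \<epsilon> ^ Suc n) * (deriv ^^ n) \<phi> (x / \<epsilon>))" for n
  proof (induction n)
    case 0
    show ?case by (simp add: rescale_def field_simps)
  next
    case (Suc n)
    have "(deriv ^^ Suc n) (rescale \<epsilon> \<phi>) =
        deriv (\<lambda>x. (1 / \<epsilon> ^ Suc n) * (deriv ^^ n) \<phi> (x / \<epsilon>))"
      using Suc by simp
    also have "\<dots> = (\<lambda>x. (1 / \<epsilon> ^ Suc (Suc n)) * (deriv ^^ Suc n) \<phi> (x / \<epsilon>))"
      unfolding fun_eq_iff DERIV_imp_deriv[OF der] by (simp add: field_simps)
    finally show ?case .
  qed
  have smooth: "(deriv ^^ n) (rescale \<epsilon> \<phi>) differentiable_on UNIV" for n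
    unfolding iter differentiable_on_def using der real_differentiable_def by blast
  have "{x. rescale \<epsilon> \<phi> x \<noteq> 0} = (*\<^sub>R) \<epsilon> ` {x. \<phi> x \<noteq> 0}"
  proof (intro equalityI subsetI)
    fix x assume "x \<in> {x. rescale \<epsilon> \<phi> x \<noteq> 0}"
    then show "x \<in> (*\<^sub>R) \<epsilon> ` {x. \<phi> x \<noteq> 0}"
      using assms(2) by (intro image_eqI[of _ _ "x / \<epsilon>"]) (auto simp: rescale_def)
  qed (use assms(2) in \<open>auto simp: rescale_def\<close>)
  then have "supp (rescale \<epsilon> \<phi>) = (*\<^sub>R) \<epsilon> ` supp \<phi>"
    by (simp only: supp_def closure_scaleR)
  then have comp: "compact (supp (rescale \<epsilon> \<phi>))"
    using compact_scaling[of "supp \<phi>" \<epsilon>] assms(1) by (simp only: A0_def Cc_infinity_def mem_Collect_eq)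
  obtain c where c: "\<forall>\<^sub>F x in nhds 0. \<phi> x = c"
    using assms(1) by (auto simp: A0_def)
  have "((\<lambda>x. x / \<epsilon>) \<longlongrightarrow> 0 / \<epsilon>) (nhds 0)"
    using assms(2) by (intro tendsto_intros) (auto simp: filterlim_ident)
  then have "\<forall>\<^sub>F x in nhds 0. \<phi> (x / \<epsilon>) = c"
    using eventually_compose_filterlim[OF c] by simp
  then have const: "\<forall>\<^sub>F x in nhds 0. rescale \<epsilon> \<phi> x = inverse \<epsilon> * c"
    by eventually_elim (simp add: rescale_def)
  have "(LBINT x:{0..}. rescale \<epsilon> \<phi> x) = \<bar>\<epsilon>\<bar> *\<^sub>R (LBINT x. indicator {0..} (0 + \<epsilon> * x) *\<^sub>R rescale \<epsilon> \<phi> (0 + \<epsilon> * x))"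
    unfolding set_lebesgue_integral_def using assms(2)
    by (intro lborel_integral_real_affine) auto
  also have "\<dots> = (LBINT x. \<epsilon> * (indicator {0..} (0 + \<epsilon> * x) *\<^sub>R rescale \<epsilon> \<phi> (0 + \<epsilon> * x)))"
    using assms(2) by simp
  also have "\<dots> = (LBINT x:{0..}. \<phi> x)"
    unfolding set_lebesgue_integral_def using assms(2)
    by (intro Bochner_Integration.integral_cong)
       (auto simp: rescale_def indicator_def zero_le_mult_iff)
  also have "\<dots> = 1 / 2"
    using assms(1) by (simp add: A0_def)
  finally have int: "(LBINT x:{0..}. rescale \<epsilon> \<phi> x) = 1 / 2" .
  have "rescale \<epsilon> \<phi> (- x) = rescale \<epsilon> \<phi> x" for x
    using assms(1) by (auto simp: A0_def rescale_def)
  with smooth comp const int show ?thesis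
    by (auto simp: A0_def Cc_infinity_def)
qed

lemma A_subset_A0: "A q \<subseteq> A0"
  by (auto simp: A_def)

lemma A_antimono: "p \<le> q \<Longrightarrow> A q \<subseteq> A p"
  by (auto simp: A_def)

lemma power_bounded_mono:
  assumes "power_bounded v \<phi> b" "a \<le> b"
  shows "power_bounded v \<phi> a"
proof -
  obtain C \<eta> where C: "C > 0" "\<eta> > 0"
    "\<And>\<epsilon>. \<epsilon> \<in> {0<..1} \<Longrightarrow> \<epsilon> < \<eta> \<Longrightarrow> norm (v (rescale \<epsilon> \<phi>)) \<le> C * \<epsilon> powr b"
    using assms(1) unfolding power_bounded_def by blast
  have "norm (v (rescale \<epsilon> \<phi>)) \<le> C * \<epsilon> powr a" if "\<epsilon> \<in> {0<..1}" "\<epsilon> < \<eta>" for \<epsilon>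
  proof -
    have "C * \<epsilon> powr b \<le> C * \<epsilon> powr a"
      using that C(1) assms(2) by (intro mult_left_mono powr_mono') auto
    with C(3)[OF that] show ?thesis by simp
  qed
  with C(1,2) show ?thesis unfolding power_bounded_def by blast
qed

lemma power_bounded_add:
  assumes "power_bounded u \<phi> a" "power_bounded v \<phi> a" "\<phi> \<in> A0"
  shows "power_bounded (\<lambda>\<phi>\<in>A0. u \<phi> + v \<phi>) \<phi> a"
proof -
  obtain C \<eta> where C: "C > 0" "\<eta> > 0"
    "\<And>\<epsilon>. \<epsilon> \<in> {0<..1} \<Longrightarrow> \<epsilon> < \<eta> \<Longrightarrow> norm (u (rescale \<epsilon> \<phi>)) \<le> C * \<epsilon> powr a"
    using assms(1) unfolding power_bounded_def by blast
  obtain D \<theta> where D: "D > 0" "\<theta> > 0"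
    "\<And>\<epsilon>. \<epsilon> \<in> {0<..1} \<Longrightarrow> \<epsilon> < \<theta> \<Longrightarrow> norm (v (rescale \<epsilon> \<phi>)) \<le> D * \<epsilon> powr a"
    using assms(2) unfolding power_bounded_def by blast
  have "norm ((\<lambda>\<phi>\<in>A0. u \<phi> + v \<phi>) (rescale \<epsilon> \<phi>)) \<le> (C + D) * \<epsilon> powr a"
    if "\<epsilon> \<in> {0<..1}" "\<epsilon> < min \<eta> \<theta>" for \<epsilon>
    using C(3)[of \<epsilon>] D(3)[of \<epsilon>] that rescale_in_A0[OF assms(3), of \<epsilon>]
      norm_triangle_ineq[of "u (rescale \<epsilon> \<phi>)" "v (rescale \<epsilon> \<phi>)"]
    by (simp add: distrib_right)
  moreover have "C + D > 0" "min \<eta> \<theta> > 0" using C D by auto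
  ultimately show ?thesis unfolding power_bounded_def by blast
qed

lemma power_bounded_mult:
  assumes "power_bounded u \<phi> a" "power_bounded v \<phi> b" "\<phi> \<in> A0"
  shows "power_bounded (\<lambda>\<phi>\<in>A0. u \<phi> * v \<phi>) \<phi> (a + b)"
proof -
  obtain C \<eta> where C: "C > 0" "\<eta> > 0"
    "\<And>\<epsilon>. \<epsilon> \<in> {0<..1} \<Longrightarrow> \<epsilon> < \<eta> \<Longrightarrow> norm (u (rescale \<epsilon> \<phi>)) \<le> C * \<epsilon> powr a"
    using assms(1) unfolding power_bounded_def by blast
  obtain D \<theta> where D: "D > 0" "\<theta> > 0"
    "\<And>\<epsilon>. \<epsilon> \<in> {0<..1} \<Longrightarrow> \<epsilon> < \<theta> \<Longrightarrow> norm (v (rescale \<epsilon> \<phi>)) \<le> D * \<epsilon> powr b"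
    using assms(2) unfolding power_bounded_def by blast
  have "norm ((\<lambda>\<phi>\<in>A0. u \<phi> * v \<phi>) (rescale \<epsilon> \<phi>)) \<le> (C * D) * \<epsilon> powr (a + b)"
    if "\<epsilon> \<in> {0<..1}" "\<epsilon> < min \<eta> \<theta>" for \<epsilon>
  proof -
    have "norm (u (rescale \<epsilon> \<phi>)) * norm (v (rescale \<epsilon> \<phi>)) \<le> (C * \<epsilon> powr a) * (D * \<epsilon> powr b)"
      using C(1) C(3)[of \<epsilon>] D(3)[of \<epsilon>] that by (intro mult_mono) auto
    then show ?thesis
      using that rescale_in_A0[OF assms(3), of \<epsilon>] by (simp add: norm_mult powr_add mult_ac)
  qed
  moreover have "C * D > 0" "min \<eta> \<theta> > 0" using C D by auto
  ultimately show ?thesis unfolding power_bounded_def by blast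
qed

lemma power_bounded_const:
  assumes "\<phi> \<in> A0"
  shows "power_bounded (\<lambda>\<phi>\<in>A0. c) \<phi> 0"
  unfolding power_bounded_def using rescale_in_A0[OF assms]
  by (intro exI[of _ "norm c + 1"] exI[of _ 1] conjI) (auto simp: add_nonneg_pos)

lemma power_bounded_zero:
  assumes "\<phi> \<in> A0"
  shows "power_bounded (\<lambda>\<phi>\<in>A0. 0) \<phi> a"
  unfolding power_bounded_def using rescale_in_A0[OF assms]
  by (intro exI[of _ 1] conjI) auto

lemma E_M_add:
  assumes "u \<in> E_M" "v \<in> E_M"
  shows "(\<lambda>\<phi>\<in>A0. u \<phi> + v \<phi>) \<in> E_M"
proof -
  obtain p where p: "\<And>\<phi>. \<phi> \<in> A p \<Longrightarrow> power_bounded u \<phi> (- real p)"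
    using assms(1) unfolding E_M_def by blast
  obtain q where q: "\<And>\<phi>. \<phi> \<in> A q \<Longrightarrow> power_bounded v \<phi> (- real q)"
    using assms(2) unfolding E_M_def by blast
  have "power_bounded (\<lambda>\<phi>\<in>A0. u \<phi> + v \<phi>) \<phi> (- real (max p q))" if "\<phi> \<in> A (max p q)" for \<phi>
  proof (rule power_bounded_add)
    have "\<phi> \<in> A p" "\<phi> \<in> A q"
      using that A_antimono[of p "max p q"] A_antimono[of q "max p q"] by auto
    then show "power_bounded u \<phi> (- real (max p q))" "power_bounded v \<phi> (- real (max p q))"
      using power_bounded_mono[OF p] power_bounded_mono[OF q] by simp_all
  qed (use that A_subset_A0 in blast)
  then show ?thesis unfolding E_M_def by auto
qed

lemma E_M_mult:
  assumes "u \<in> E_M" "v \<in> E_M"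
  shows "(\<lambda>\<phi>\<in>A0. u \<phi> * v \<phi>) \<in> E_M"
proof -
  obtain p where p: "\<And>\<phi>. \<phi> \<in> A p \<Longrightarrow> power_bounded u \<phi> (- real p)"
    using assms(1) unfolding E_M_def by blast
  obtain q where q: "\<And>\<phi>. \<phi> \<in> A q \<Longrightarrow> power_bounded v \<phi> (- real q)"
    using assms(2) unfolding E_M_def by blast
  have "power_bounded (\<lambda>\<phi>\<in>A0. u \<phi> * v \<phi>) \<phi> (- real (p + q))" if "\<phi> \<in> A (p + q)" for \<phi>
  proof -
    have "\<phi> \<in> A p" "\<phi> \<in> A q" "\<phi> \<in> A0"
      using that A_antimono[of p "p + q"] A_antimono[of q "p + q"] A_subset_A0 by auto
    then show ?thesis
      using power_bounded_mult[OF p q, of \<phi>] by (simp add: algebra_simps)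
  qed
  then show ?thesis unfolding E_M_def by blast
qed

lemma E_M_const: "(\<lambda>\<phi>\<in>A0. c) \<in> E_M"
proof -
  have "power_bounded (\<lambda>\<phi>\<in>A0. c) \<phi> (- real 0)" if "\<phi> \<in> A 0" for \<phi>
    using power_bounded_const[of \<phi> c] that A_subset_A0 by auto
  then show ?thesis unfolding E_M_def by blast
qed

lemma restrict_E_M: "v \<in> E_M \<Longrightarrow> restrict v A0 = v"
  by (auto simp: E_M_def extensional_restrict)

lemma E_ring_cring: "cring E_ring"
proof (rule cringI)
  show "abelian_group (E_ring :: ((real \<Rightarrow> real) \<Rightarrow> 'a) ring)"
  proof (rule abelian_groupI)
    fix u v w :: "(real \<Rightarrow> real) \<Rightarrow> 'a"
    show "v \<oplus>\<^bsub>E_ring\<^esub> w = w \<oplus>\<^bsub>E_ring\<^esub> v"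
      by (simp add: E_ring_def add.commute)
    show "(u \<oplus>\<^bsub>E_ring\<^esub> v) \<oplus>\<^bsub>E_ring\<^esub> w = u \<oplus>\<^bsub>E_ring\<^esub> (v \<oplus>\<^bsub>E_ring\<^esub> w)"
      by (simp add: E_ring_def add.assoc cong: restrict_cong)
    assume v: "v \<in> carrier E_ring"
    show "\<zero>\<^bsub>E_ring\<^esub> \<oplus>\<^bsub>E_ring\<^esub> v = v"
      using v by (simp add: E_ring_def restrict_E_M cong: restrict_cong)
    show "v \<oplus>\<^bsub>E_ring\<^esub> w \<in> carrier E_ring" if "w \<in> carrier E_ring"
      using v that by (simp add: E_ring_def E_M_add)
    have "(\<lambda>\<phi>\<in>A0. (\<lambda>\<phi>\<in>A0. - 1) \<phi> * v \<phi>) \<in> carrier E_ring"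
      using v E_M_mult[OF E_M_const[of "-1"]] by (simp add: E_ring_def)
    moreover have "(\<lambda>\<phi>\<in>A0. (\<lambda>\<phi>\<in>A0. - 1) \<phi> * v \<phi>) \<oplus>\<^bsub>E_ring\<^esub> v = \<zero>\<^bsub>E_ring\<^esub>"
      by (simp add: E_ring_def cong: restrict_cong)
    ultimately show "\<exists>w\<in>carrier E_ring. w \<oplus>\<^bsub>E_ring\<^esub> v = \<zero>\<^bsub>E_ring\<^esub>"
      by blast
  qed (simp add: E_ring_def E_M_const)
  show "comm_monoid (E_ring :: ((real \<Rightarrow> real) \<Rightarrow> 'a) ring)"
  proof (rule comm_monoidI)
    fix u v w :: "(real \<Rightarrow> real) \<Rightarrow> 'a"
    show "v \<otimes>\<^bsub>E_ring\<^esub> w = w \<otimes>\<^bsub>E_ring\<^esub> v"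
      by (simp add: E_ring_def mult.commute)
    show "(u \<otimes>\<^bsub>E_ring\<^esub> v) \<otimes>\<^bsub>E_ring\<^esub> w = u \<otimes>\<^bsub>E_ring\<^esub> (v \<otimes>\<^bsub>E_ring\<^esub> w)"
      by (simp add: E_ring_def mult.assoc cong: restrict_cong)
    assume v: "v \<in> carrier E_ring"
    show "\<one>\<^bsub>E_ring\<^esub> \<otimes>\<^bsub>E_ring\<^esub> v = v"
      using v by (simp add: E_ring_def restrict_E_M cong: restrict_cong)
    show "v \<otimes>\<^bsub>E_ring\<^esub> w \<in> carrier E_ring" if "w \<in> carrier E_ring"
      using v that by (simp add: E_ring_def E_M_mult)
  qed (simp add: E_ring_def E_M_const)
qed (simp add: E_ring_def distrib_right cong: restrict_cong)

lemma N_ideal_ideal: "ideal N_ideal E_ring"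
proof -
  interpret E: cring "E_ring :: ((real \<Rightarrow> real) \<Rightarrow> 'a) ring" by (rule E_ring_cring)
  have sub: "N_ideal \<subseteq> E_M" by (auto simp: N_ideal_def)
  have mult: "(\<lambda>\<phi>\<in>A0. u \<phi> * v \<phi>) \<in> N_ideal" if u: "u \<in> E_M" and v: "v \<in> N_ideal"
    for u v :: "(real \<Rightarrow> real) \<Rightarrow> 'a"
  proof -
    obtain p where p: "\<And>\<phi>. \<phi> \<in> A p \<Longrightarrow> power_bounded u \<phi> (- real p)"
      using u unfolding E_M_def by blast
    obtain r \<gamma> where r: "\<gamma> \<in> Gam"
      "\<And>q \<phi>. r \<le> q \<Longrightarrow> \<phi> \<in> A q \<Longrightarrow> power_bounded v \<phi> (\<gamma> q - real r)"
      using v unfolding N_ideal_def by blast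
    have "power_bounded (\<lambda>\<phi>\<in>A0. u \<phi> * v \<phi>) \<phi> (\<gamma> q - real (p + r))"
      if "p + r \<le> q" "\<phi> \<in> A q" for q \<phi>
    proof -
      have "\<phi> \<in> A p" "\<phi> \<in> A0"
        using that A_antimono[of p q] A_subset_A0 by auto
      then show ?thesis
        using power_bounded_mult[OF p r(2), of \<phi> q] that by (simp add: algebra_simps)
    qed
    moreover have "(\<lambda>\<phi>\<in>A0. u \<phi> * v \<phi>) \<in> E_M"
      using u v sub by (auto intro: E_M_mult)
    ultimately show ?thesis
      using r(1) unfolding N_ideal_def by blast
  qed
  have add: "(\<lambda>\<phi>\<in>A0. u \<phi> + v \<phi>) \<in> N_ideal" if u: "u \<in> N_ideal" and v: "v \<in> N_ideal"
    for u v :: "(real \<Rightarrow> real) \<Rightarrow> 'a"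
  proof -
    obtain p \<gamma> where p: "\<gamma> \<in> Gam"
      "\<And>q \<phi>. p \<le> q \<Longrightarrow> \<phi> \<in> A q \<Longrightarrow> power_bounded u \<phi> (\<gamma> q - real p)"
      using u unfolding N_ideal_def by blast
    obtain r \<delta> where r: "\<delta> \<in> Gam"
      "\<And>q \<phi>. r \<le> q \<Longrightarrow> \<phi> \<in> A q \<Longrightarrow> power_bounded v \<phi> (\<delta> q - real r)"
      using v unfolding N_ideal_def by blast
    define \<kappa> where "\<kappa> n = min (\<gamma> n) (\<delta> n)" for n
    have "\<kappa> m < \<kappa> n" if "m < n" for m n
    proof -
      have "\<gamma> m < \<gamma> n" "\<delta> m < \<delta> n"
        using p(1) r(1) that by (auto simp: Gam_def dest: strict_monoD)
      then show ?thesis by (auto simp: \<kappa>_def)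
    qed
    then have "strict_mono \<kappa>" by (rule strict_monoI)
    moreover have "filterlim \<kappa> at_top sequentially"
      using p(1) r(1) by (auto simp: Gam_def \<kappa>_def filterlim_at_top eventually_conj_iff)
    ultimately have \<kappa>: "\<kappa> \<in> Gam"
      using p(1) r(1) by (auto simp: Gam_def \<kappa>_def)
    have "power_bounded (\<lambda>\<phi>\<in>A0. u \<phi> + v \<phi>) \<phi> (\<kappa> q - real (max p r))"
      if "max p r \<le> q" "\<phi> \<in> A q" for q \<phi>
    proof (rule power_bounded_add)
      show "power_bounded u \<phi> (\<kappa> q - real (max p r))"
        by (rule power_bounded_mono[OF p(2)]) (use that in \<open>auto simp: \<kappa>_def\<close>)
      show "power_bounded v \<phi> (\<kappa> q - real (max p r))"
        by (rule power_bounded_mono[OF r(2)]) (use that in \<open>auto simp: \<kappa>_def\<close>)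
    qed (use that A_subset_A0 in blast)
    moreover have "(\<lambda>\<phi>\<in>A0. u \<phi> + v \<phi>) \<in> E_M"
      using u v sub by (auto intro: E_M_add)
    ultimately show ?thesis
      using \<kappa> unfolding N_ideal_def by blast
  qed
  have "real \<in> Gam"
    by (auto simp: Gam_def strict_mono_def filterlim_real_sequentially)
  moreover have "power_bounded (\<lambda>\<phi>\<in>A0. 0 :: 'a) \<phi> a" if "\<phi> \<in> A q" for \<phi> q a
    using power_bounded_zero that A_subset_A0 by blast
  ultimately have zero: "(\<lambda>\<phi>\<in>A0. 0 :: 'a) \<in> N_ideal"
    unfolding N_ideal_def using E_M_const by blast
  have neg: "\<ominus>\<^bsub>E_ring\<^esub> v \<in> N_ideal" if v: "v \<in> N_ideal" for v :: "(real \<Rightarrow> real) \<Rightarrow> 'a"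
  proof -
    define w :: "(real \<Rightarrow> real) \<Rightarrow> 'a" where "w = (\<lambda>\<phi>\<in>A0. (\<lambda>\<phi>\<in>A0. - 1) \<phi> * v \<phi>)"
    have w: "w \<in> N_ideal" unfolding w_def by (intro mult E_M_const v)
    have "w \<oplus>\<^bsub>E_ring\<^esub> v = \<zero>\<^bsub>E_ring\<^esub>"
      by (simp add: w_def E_ring_def cong: restrict_cong)
    then have "\<ominus>\<^bsub>E_ring\<^esub> v = w"
      using v w sub by (intro E.minus_equality) (auto simp: E_ring_def)
    with w show ?thesis by simp
  qed
  show ?thesis
  proof (rule idealI)
    show "subgroup N_ideal (add_monoid (E_ring :: ((real \<Rightarrow> real) \<Rightarrow> 'a) ring))"
    proof (rule group.subgroupI[OF E.a_group])
      fix v :: "(real \<Rightarrow> real) \<Rightarrow> 'a" assume "v \<in> N_ideal"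
      then show "inv\<^bsub>add_monoid E_ring\<^esub> v \<in> N_ideal"
        using neg by (simp add: a_inv_def)
    qed (use sub add zero in \<open>auto simp: E_ring_def\<close>)
    fix u v :: "(real \<Rightarrow> real) \<Rightarrow> 'a" assume uv: "v \<in> N_ideal" "u \<in> carrier E_ring"
    then show "u \<otimes>\<^bsub>E_ring\<^esub> v \<in> N_ideal"
      using mult by (auto simp: E_ring_def)
    with uv sub show "v \<otimes>\<^bsub>E_ring\<^esub> u \<in> N_ideal"
      using E.m_comm[of u v] by (auto simp: E_ring_def)
  qed (rule E.ring_axioms)
qed

definition K_f :: "((real \<Rightarrow> real) \<Rightarrow> 'k::real_normed_field) set ring"
  where "K_f = E_ring Quot N_ideal"

definition is_representative ::
    "((real \<Rightarrow> real) \<Rightarrow> 'k::real_normed_field) \<Rightarrow> ((real \<Rightarrow> real) \<Rightarrow> 'k) set \<Rightarrow> bool"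
  where "is_representative v x \<longleftrightarrow> v \<in> E_M \<and> N_ideal +>\<^bsub>E_ring\<^esub> v = x"

lemma K_f_cring: "cring K_f"
  unfolding K_f_def by (intro ideal.quotient_is_cring N_ideal_ideal E_ring_cring)

end

theory Submission
  imports Defs
begin

text \<open>
  The class of \<open>v\<close> is a unit exactly when \<open>v w - 1\<close> lies in the ideal for some \<open>w\<close> in \<open>E_M\<close>
  (\<open>coset_in_Units_iff\<close>). The elements of \<open>E_M\<close> are called moderate and those of \<open>N_ideal\<close>
  negligible.

  If \<open>v\<close> is bounded below by \<open>i(\<phi>\<^sub>\<epsilon>)\<^sup>r = (\<epsilon> i(\<phi>))\<^sup>r\<close>, then its pointwise reciprocal (with
  the value \<open>0\<close> where \<open>v\<close> vanishes) is bounded by a constant times \<open>\<epsilon> powr (-r)\<close>; here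
  \<open>i(\<phi>) > 0\<close> is essential, and holds because \<open>\<phi>\<close> is even and not concentrated at \<open>0\<close>. So the
  reciprocal is moderate (\<open>lower_bound_imp_inverse\<close>), and \<open>v w - 1\<close> even vanishes at \<open>\<phi>\<^sub>\<epsilon>\<close> for all small \<open>\<epsilon>\<close>.

  Conversely let \<open>v w = 1 + n\<close> with \<open>n\<close> in the ideal. Since \<open>\<gamma>\<close> is unbounded, there is one
  \<open>q\<close> with \<open>\<gamma> q > p\<close>, so that \<open>n(\<phi>\<^sub>\<epsilon>)\<close> tends to \<open>0\<close> for every \<open>\<phi>\<close> in \<open>A q\<close>; there
  \<open>\<bar>v w\<bar>\<close> is eventually at least \<open>1/2\<close>, and the polynomial upper bound for \<open>w\<close> is a lower
  bound for \<open>v\<close> (\<open>inverse_imp_lower_bound\<close>). Nothing is known off \<open>A q\<close>, but this does not matter: the classes only see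
  \<open>A q\<close> for large \<open>q\<close>, and \<open>A q\<close> and its complement are both stable under rescaling, so
  \<open>v\<close> may be replaced by \<open>1\<close> off \<open>A q\<close> without leaving its class (\<open>lower_bound_extend\<close>).
\<close>

section \<open>Rescaling and the diameter of the support\<close>

lemma supp_rescale:
  assumes "\<epsilon> > 0"
  shows "supp (rescale \<epsilon> \<phi>) = (*\<^sub>R) \<epsilon> ` supp \<phi>"
proof -
  have "{x. rescale \<epsilon> \<phi> x \<noteq> 0} = (*\<^sub>R) \<epsilon> ` {x. \<phi> x \<noteq> 0}"
  proof (intro equalityI subsetI)
    fix x assume "x \<in> {x. rescale \<epsilon> \<phi> x \<noteq> 0}"
    then show "x \<in> (*\<^sub>R) \<epsilon> ` {x. \<phi> x \<noteq> 0}"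
      using assms by (intro image_eqI[of _ _ "x / \<epsilon>"]) (auto simp: rescale_def)
  qed (use assms in \<open>auto simp: rescale_def\<close>)
  then show ?thesis
    by (simp only: supp_def closure_scaleR)
qed

lemma diameter_scaleR:
  fixes S :: "'a::real_normed_vector set"
  assumes "bounded S" "c > 0"
  shows "diameter ((*\<^sub>R) c ` S) = c * diameter S"
proof (cases "S = {}")
  case False
  have le: "diameter ((*\<^sub>R) c ` T) \<le> c * diameter T"
    if T: "bounded T" "T \<noteq> {}" "c > 0" for T :: "'a set" and c :: real
  proof (rule diameter_le)
    fix x y assume "x \<in> (*\<^sub>R) c ` T" "y \<in> (*\<^sub>R) c ` T"
    then obtain a b where ab: "a \<in> T" "b \<in> T" "x = c *\<^sub>R a" "y = c *\<^sub>R b" by blast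
    then have "norm (x - y) = c * dist a b"
      using T(3) by (simp add: dist_norm flip: scaleR_diff_right)
    also have "\<dots> \<le> c * diameter T"
      using T ab by (intro mult_left_mono diameter_bounded_bound) auto
    finally show "norm (x - y) \<le> c * diameter T" .
  qed (use T in auto)
  have "diameter ((*\<^sub>R) (inverse c) ` (*\<^sub>R) c ` S) \<le> inverse c * diameter ((*\<^sub>R) c ` S)"
    using assms False by (intro le bounded_scaling) auto
  then have "c * diameter S \<le> diameter ((*\<^sub>R) c ` S)"
    using assms(2) by (simp add: image_image field_simps)
  with le[OF assms(1) False assms(2)] show ?thesis by simp
qed simp

lemma bounded_supp_A0: "\<phi> \<in> A0 \<Longrightarrow> bounded (supp \<phi>)"
  by (simp add: A0_def Cc_infinity_def compact_imp_bounded)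

lemma diam_supp_rescale:
  assumes "\<phi> \<in> A0" "\<epsilon> > 0"
  shows "diam_supp (rescale \<epsilon> \<phi>) = \<epsilon> * diam_supp \<phi>"
  by (simp add: diam_supp_def supp_rescale diameter_scaleR bounded_supp_A0 assms
      del: real_scaleR_def)

text \<open>
  The integral condition makes \<open>\<phi>\<close> nonzero at some \<open>x \<noteq> 0\<close>, and evenness puts both \<open>x\<close> and
  \<open>- x\<close> into the support.
\<close>

lemma diam_supp_pos:
  assumes "\<phi> \<in> A0"
  shows "diam_supp \<phi> > 0"
proof -
  have even: "\<phi> (- x) = \<phi> x" for x
    using assms by (auto simp: A0_def)
  have int: "(LBINT x:{0..}. \<phi> x) = 1 / 2"
    using assms by (auto simp: A0_def)
  have "\<exists>x. x \<noteq> 0 \<and> \<phi> x \<noteq> 0"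
  proof (rule ccontr)
    assume "\<not> ?thesis"
    then have zero: "\<phi> x = 0" if "x \<noteq> 0" for x
      using that by blast
    have "(LBINT x:{0..}. \<phi> x) = 0"
      unfolding set_lebesgue_integral_def
    proof (rule integral_eq_zero_AE)
      show "AE x in lborel. indicator {0..} x *\<^sub>R \<phi> x = 0"
        using AE_lborel_singleton[of "0::real"] by eventually_elim (simp add: zero)
    qed
    with int show False by simp
  qed
  then obtain x where x: "x \<noteq> 0" "\<phi> x \<noteq> 0" by blast
  have "x \<in> supp \<phi>" "- x \<in> supp \<phi>"
    unfolding supp_def using x even by (auto intro!: closure_subset[THEN subsetD])
  then have "dist x (- x) \<le> diam_supp \<phi>"
    unfolding diam_supp_def by (intro diameter_bounded_bound bounded_supp_A0 assms)
  moreover have "dist x (- x) > 0" using x by simp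
  ultimately show ?thesis by linarith
qed

lemma rescale_inverse: "\<epsilon> > 0 \<Longrightarrow> rescale (inverse \<epsilon>) (rescale \<epsilon> \<phi>) = \<phi>"
  by (auto simp: rescale_def fun_eq_iff)

text \<open>
  Substituting \<open>x = \<epsilon> y\<close> multiplies each moment by a power of \<open>\<epsilon>\<close>, so vanishing moments stay
  zero.
\<close>

lemma rescale_in_A:
  assumes "\<phi> \<in> A q" "\<epsilon> > 0"
  shows "rescale \<epsilon> \<phi> \<in> A q"
proof -
  have moment: "(LBINT x:{0..}. x powr a * rescale \<epsilon> \<phi> x)
      = \<epsilon> powr a * (LBINT x:{0..}. x powr a * \<phi> x)" for a
  proof -
    have "(LBINT x:{0..}. x powr a * rescale \<epsilon> \<phi> x)
        = \<bar>\<epsilon>\<bar> *\<^sub>R (LBINT x. indicator {0..} (0 + \<epsilon> * x) *\<^sub>R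
            ((0 + \<epsilon> * x) powr a * rescale \<epsilon> \<phi> (0 + \<epsilon> * x)))"
      unfolding set_lebesgue_integral_def using assms(2)
      by (intro lborel_integral_real_affine) auto
    also have "\<dots> = (LBINT x. \<epsilon> * (indicator {0..} (0 + \<epsilon> * x) *\<^sub>R
            ((0 + \<epsilon> * x) powr a * rescale \<epsilon> \<phi> (0 + \<epsilon> * x))))"
      using assms(2) by simp
    also have "\<dots> = (LBINT x. \<epsilon> powr a * (indicator {0..} x *\<^sub>R (x powr a * \<phi> x)))"
      using assms(2)
      by (intro Bochner_Integration.integral_cong)
         (auto simp: rescale_def indicator_def zero_le_mult_iff powr_mult)
    finally show ?thesis
      unfolding set_lebesgue_integral_def by simp
  qed
  show ?thesis
    using assms by (auto simp: A_def rescale_in_A0 moment)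
qed

lemma rescale_in_A_iff: "\<epsilon> > 0 \<Longrightarrow> rescale \<epsilon> \<phi> \<in> A q \<longleftrightarrow> \<phi> \<in> A q"
  using rescale_in_A[of \<phi> q \<epsilon>] rescale_in_A[of "rescale \<epsilon> \<phi>" q "inverse \<epsilon>"]
  by (auto simp: rescale_inverse)

section \<open>Moderate and negligible functions\<close>

lemma power_bounded_iff_eventually:
  "power_bounded v \<phi> a \<longleftrightarrow>
    (\<exists>C>0. \<forall>\<^sub>F \<epsilon> in at_right 0. norm (v (rescale \<epsilon> \<phi>)) \<le> C * \<epsilon> powr a)"
proof -
  \<comment> \<open>The side condition \<open>\<epsilon> \<le> 1\<close> is absorbed by shrinking \<open>\<eta>\<close>.\<close>
  have "(\<exists>\<eta>>0. \<forall>\<epsilon>\<in>{0<..1}. \<epsilon> < \<eta> \<longrightarrow> P \<epsilon>) \<longleftrightarrow> (\<forall>\<^sub>F \<epsilon> in at_right 0. P \<epsilon>)"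
    for P :: "real \<Rightarrow> bool"
  proof
    assume "\<exists>\<eta>>0. \<forall>\<epsilon>\<in>{0<..1}. \<epsilon> < \<eta> \<longrightarrow> P \<epsilon>"
    then obtain \<eta> where "\<eta> > 0" "\<forall>\<epsilon>\<in>{0<..1}. \<epsilon> < \<eta> \<longrightarrow> P \<epsilon>" by blast
    then show "\<forall>\<^sub>F \<epsilon> in at_right 0. P \<epsilon>"
      unfolding eventually_at_right_field by (intro exI[of _ "min 1 \<eta>"]) auto
  qed (auto simp: eventually_at_right_field)
  then show ?thesis unfolding power_bounded_def by simp
qed

text \<open>
  Negligibility only tests \<open>A q\<close> for large \<open>q\<close> and small \<open>\<epsilon>\<close>. Both directions of the
  characterisation of units use it in this form.
\<close>

lemma eventually_zero_imp_N_ideal: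
  fixes u :: "(real \<Rightarrow> real) \<Rightarrow> 'k::real_normed_field"
  assumes "u \<in> extensional A0"
    and zero: "\<And>\<phi>. \<phi> \<in> A q \<Longrightarrow> \<forall>\<^sub>F \<epsilon> in at_right 0. u (rescale \<epsilon> \<phi>) = 0"
  shows "u \<in> N_ideal"
proof -
  have "power_bounded u \<phi> a" if "\<phi> \<in> A q'" "q \<le> q'" for \<phi> q' a
  proof -
    have "\<phi> \<in> A q" using that A_antimono by blast
    from zero[OF this]
    have "\<forall>\<^sub>F \<epsilon> in at_right 0. norm (u (rescale \<epsilon> \<phi>)) \<le> 1 * \<epsilon> powr a"
      by (rule eventually_mono) simp
    then show ?thesis
      unfolding power_bounded_iff_eventually by (intro exI[of _ 1]) auto
  qed
  moreover have "real \<in> Gam"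
    by (auto simp: Gam_def strict_mono_def filterlim_real_sequentially)
  ultimately show ?thesis
    using assms(1) unfolding N_ideal_def E_M_def by blast
qed

lemma E_M_E:
  assumes "v \<in> E_M"
  obtains p where "\<And>\<phi> q. \<phi> \<in> A q \<Longrightarrow> p \<le> q \<Longrightarrow> power_bounded v \<phi> (- real p)"
proof -
  obtain p where p: "\<And>\<phi>. \<phi> \<in> A p \<Longrightarrow> power_bounded v \<phi> (- real p)"
    using assms unfolding E_M_def by blast
  show ?thesis
    by (rule that[of p], rule p) (use A_antimono in blast)
qed

text \<open>Since \<open>\<gamma>\<close> is unbounded, the exponents \<open>\<gamma> q - p\<close> of a negligible function become positive.\<close>

lemma N_ideal_tendsto_zero:
  fixes n :: "(real \<Rightarrow> real) \<Rightarrow> 'k::real_normed_field"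
  assumes "n \<in> N_ideal"
  obtains q\<^sub>0 where "\<And>\<phi> q. \<phi> \<in> A q \<Longrightarrow> q\<^sub>0 \<le> q \<Longrightarrow> ((\<lambda>\<epsilon>. n (rescale \<epsilon> \<phi>)) \<longlongrightarrow> 0) (at_right 0)"
proof -
  obtain p \<gamma> where \<gamma>: "\<gamma> \<in> Gam"
    "\<And>q \<phi>. p \<le> q \<Longrightarrow> \<phi> \<in> A q \<Longrightarrow> power_bounded n \<phi> (\<gamma> q - real p)"
    using assms unfolding N_ideal_def by blast
  have "\<forall>\<^sub>F q in sequentially. \<gamma> q > real p"
    using \<gamma>(1) by (auto simp: Gam_def filterlim_at_top_dense)
  then obtain q\<^sub>1 where q\<^sub>1: "\<And>q. q\<^sub>1 \<le> q \<Longrightarrow> \<gamma> q > real p"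
    unfolding eventually_sequentially by blast
  have "((\<lambda>\<epsilon>. n (rescale \<epsilon> \<phi>)) \<longlongrightarrow> 0) (at_right 0)" if \<phi>: "\<phi> \<in> A q" and q: "max p q\<^sub>1 \<le> q" for \<phi> q
  proof -
    obtain C where C: "\<forall>\<^sub>F \<epsilon> in at_right 0. norm (n (rescale \<epsilon> \<phi>)) \<le> C * \<epsilon> powr (\<gamma> q - real p)"
      using \<gamma>(2)[OF _ \<phi>] q unfolding power_bounded_iff_eventually by auto
    have "((\<lambda>\<epsilon>. C * \<epsilon> powr (\<gamma> q - real p)) \<longlongrightarrow> C * 0) (at_right 0)"
      using q\<^sub>1[of q] q eventually_at_right_less[of "0::real"]
      by (intro tendsto_mult tendsto_const tendsto_zero_powrI[where b = "\<gamma> q - real p"])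
         (auto elim: eventually_mono)
    then show ?thesis
      using Lim_null_comparison[OF C] by simp
  qed
  then show ?thesis by (rule that)
qed

section \<open>Units of the quotient\<close>

lemma E_ring_minus:
  fixes u v :: "(real \<Rightarrow> real) \<Rightarrow> 'k::real_normed_field"
  assumes "u \<in> E_M" "v \<in> E_M"
  shows "u \<ominus>\<^bsub>E_ring\<^esub> v = (\<lambda>\<phi>\<in>A0. u \<phi> - v \<phi>)"
proof -
  interpret E: cring "E_ring :: ((real \<Rightarrow> real) \<Rightarrow> 'k) ring" by (rule E_ring_cring)
  define w :: "(real \<Rightarrow> real) \<Rightarrow> 'k" where "w = (\<lambda>\<phi>\<in>A0. - v \<phi>)"
  have "w = (\<lambda>\<phi>\<in>A0. (\<lambda>\<phi>\<in>A0. - 1) \<phi> * v \<phi>)"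
    by (auto simp: w_def fun_eq_iff)
  then have w: "w \<in> E_M"
    using E_M_mult[OF E_M_const[of "-1"] assms(2)] by simp
  have "w \<oplus>\<^bsub>E_ring\<^esub> v = \<zero>\<^bsub>E_ring\<^esub>"
    by (simp add: E_ring_def w_def cong: restrict_cong)
  then have "\<ominus>\<^bsub>E_ring\<^esub> v = w"
    using w assms(2) by (intro E.minus_equality) (auto simp: E_ring_def)
  then have "u \<ominus>\<^bsub>E_ring\<^esub> v = u \<oplus>\<^bsub>E_ring\<^esub> w"
    by (simp add: a_minus_def)
  then show ?thesis
    by (simp add: E_ring_def w_def cong: restrict_cong)
qed

lemma coset_eq_iff:
  fixes u v :: "(real \<Rightarrow> real) \<Rightarrow> 'k::real_normed_field"
  assumes "u \<in> E_M" "v \<in> E_M"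
  shows "N_ideal +>\<^bsub>E_ring\<^esub> u = N_ideal +>\<^bsub>E_ring\<^esub> v \<longleftrightarrow> (\<lambda>\<phi>\<in>A0. u \<phi> - v \<phi>) \<in> N_ideal"
proof -
  interpret E: cring "E_ring :: ((real \<Rightarrow> real) \<Rightarrow> 'k) ring" by (rule E_ring_cring)
  have "u \<in> carrier E_ring" "v \<in> carrier E_ring"
    using assms by (auto simp: E_ring_def)
  from E.quotient_eq_iff_same_a_r_cos[OF N_ideal_ideal this] show ?thesis
    using E_ring_minus[OF assms] by simp
qed

lemma carrier_K_f: "carrier K_f = (\<lambda>v. N_ideal +>\<^bsub>E_ring\<^esub> v) ` E_M"
  by (auto simp: K_f_def FactRing_def A_RCOSETS_def' E_ring_def)

lemma coset_in_Units_iff: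
  fixes v :: "(real \<Rightarrow> real) \<Rightarrow> 'k::real_normed_field"
  assumes v: "v \<in> E_M"
  shows "N_ideal +>\<^bsub>E_ring\<^esub> v \<in> Units K_f \<longleftrightarrow>
    (\<exists>w\<in>E_M. (\<lambda>\<phi>\<in>A0. v \<phi> * w \<phi> - 1) \<in> N_ideal)"
proof -
  interpret K: cring "K_f :: ((real \<Rightarrow> real) \<Rightarrow> 'k) set ring" by (rule K_f_cring)
  have mult: "(N_ideal +>\<^bsub>E_ring\<^esub> v) \<otimes>\<^bsub>K_f\<^esub> (N_ideal +>\<^bsub>E_ring\<^esub> w) = \<one>\<^bsub>K_f\<^esub> \<longleftrightarrow>
      (\<lambda>\<phi>\<in>A0. v \<phi> * w \<phi> - 1) \<in> N_ideal" if w: "w \<in> E_M" for w :: "(real \<Rightarrow> real) \<Rightarrow> 'k"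
  proof -
    have "(N_ideal +>\<^bsub>E_ring\<^esub> v) \<otimes>\<^bsub>K_f\<^esub> (N_ideal +>\<^bsub>E_ring\<^esub> w)
        = N_ideal +>\<^bsub>E_ring\<^esub> (v \<otimes>\<^bsub>E_ring\<^esub> w)"
      using ideal.rcoset_mult_add[OF N_ideal_ideal, of v w] v w
      by (simp add: K_f_def FactRing_def) (simp add: E_ring_def)
    moreover have "\<one>\<^bsub>K_f\<^esub> = N_ideal +>\<^bsub>E_ring\<^esub> (\<lambda>\<phi>\<in>A0. 1 :: 'k)"
      by (simp add: K_f_def FactRing_def) (simp add: E_ring_def)
    moreover have "v \<otimes>\<^bsub>E_ring\<^esub> w = (\<lambda>\<phi>\<in>A0. v \<phi> * w \<phi>)"
      by (simp add: E_ring_def)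
    ultimately show ?thesis
      using coset_eq_iff[OF E_M_mult[OF v w] E_M_const[of 1]] by (simp cong: restrict_cong)
  qed
  have "N_ideal +>\<^bsub>E_ring\<^esub> v \<in> carrier K_f"
    using v by (simp add: carrier_K_f)
  then have "N_ideal +>\<^bsub>E_ring\<^esub> v \<in> Units K_f \<longleftrightarrow>
      (\<exists>y\<in>carrier K_f. (N_ideal +>\<^bsub>E_ring\<^esub> v) \<otimes>\<^bsub>K_f\<^esub> y = \<one>\<^bsub>K_f\<^esub>)"
    by (auto simp: Units_def K.m_comm)
  also have "\<dots> \<longleftrightarrow> (\<exists>w\<in>E_M. (\<lambda>\<phi>\<in>A0. v \<phi> * w \<phi> - 1) \<in> N_ideal)"
    by (simp add: carrier_K_f mult)
  finally show ?thesis .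
qed

text \<open>
  The pointwise reciprocal is moderate, because \<open>1 / \<bar>v(\<phi>\<^sub>\<epsilon>)\<bar> \<le> i(\<phi>) powr (-r) * \<epsilon> powr (-r)\<close>, and
  \<open>\<lceil>r\<rceil>\<close> serves as the exponent for all \<open>\<phi>\<close> at once.
\<close>

lemma lower_bound_imp_inverse:
  fixes v :: "(real \<Rightarrow> real) \<Rightarrow> 'k::real_normed_field"
  assumes r: "r > 0"
    and lower: "\<And>\<phi>. \<phi> \<in> A0 \<Longrightarrow>
      \<forall>\<^sub>F \<epsilon> in at_right 0. norm (v (rescale \<epsilon> \<phi>)) \<ge> diam_supp (rescale \<epsilon> \<phi>) powr r"
  shows "\<exists>w\<in>E_M. (\<lambda>\<phi>\<in>A0. v \<phi> * w \<phi> - 1) \<in> N_ideal"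
proof -
  define w where "w = (\<lambda>\<phi>\<in>A0. inverse (v \<phi>))"
  have pos: "\<forall>\<^sub>F \<epsilon> in at_right 0. (\<epsilon>::real) > 0"
    by (rule eventually_at_right_less)
  have le1: "\<forall>\<^sub>F \<epsilon> in at_right 0. (\<epsilon>::real) \<le> 1"
    by (auto simp: eventually_at_right_field intro: exI[of _ 1])
  have "power_bounded w \<phi> (- real (nat \<lceil>r\<rceil>))" if "\<phi> \<in> A0" for \<phi>
  proof -
    have d: "diam_supp \<phi> > 0" by (rule diam_supp_pos[OF that])
    have "\<forall>\<^sub>F \<epsilon> in at_right 0. norm (w (rescale \<epsilon> \<phi>)) \<le> diam_supp \<phi> powr (- r) * \<epsilon> powr (- r)"
      using lower[OF that] pos
    proof eventually_elim
      case (elim \<epsilon>)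
      have "inverse (norm (v (rescale \<epsilon> \<phi>))) \<le> inverse ((\<epsilon> * diam_supp \<phi>) powr r)"
        using elim d by (intro le_imp_inverse_le) (simp_all add: diam_supp_rescale that)
      also have "\<dots> = diam_supp \<phi> powr (- r) * \<epsilon> powr (- r)"
        using elim d by (simp add: powr_mult powr_minus)
      finally show ?case
        using elim by (simp add: w_def rescale_in_A0 that norm_inverse)
    qed
    then have "power_bounded w \<phi> (- r)"
      unfolding power_bounded_iff_eventually using d by (intro exI[of _ "diam_supp \<phi> powr (- r)"]) auto
    then show ?thesis
      by (rule power_bounded_mono) (use r in linarith)
  qed
  then have "w \<in> E_M"
    unfolding E_M_def using A_subset_A0 by (auto simp: w_def)
  moreover have "(\<lambda>\<phi>\<in>A0. v \<phi> * w \<phi> - 1) \<in> N_ideal"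
  proof (rule eventually_zero_imp_N_ideal)
    fix \<phi> assume "\<phi> \<in> A 0"
    then have \<phi>: "\<phi> \<in> A0" using A_subset_A0 by blast
    show "\<forall>\<^sub>F \<epsilon> in at_right 0. (\<lambda>\<phi>\<in>A0. v \<phi> * w \<phi> - 1) (rescale \<epsilon> \<phi>) = 0"
      using lower[OF \<phi>] pos
    proof eventually_elim
      case (elim \<epsilon>)
      have "0 < diam_supp (rescale \<epsilon> \<phi>) powr r"
        using elim diam_supp_pos[OF \<phi>] by (simp add: diam_supp_rescale \<phi>)
      with elim have "norm (v (rescale \<epsilon> \<phi>)) > 0" by linarith
      with elim show ?case
        by (simp add: w_def rescale_in_A0 \<phi>)
    qed
  qed simp
  ultimately show ?thesis by blast
qed

text \<open>
  The exponent \<open>s + 1\<close>, one more than the growth \<open>s\<close> of \<open>w\<close>, leaves a factor \<open>\<epsilon>\<close> to absorb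
  every constant that depends on \<open>\<phi>\<close>.
\<close>

lemma inverse_imp_lower_bound:
  fixes v w :: "(real \<Rightarrow> real) \<Rightarrow> 'k::real_normed_field"
  assumes w: "w \<in> E_M" and N: "(\<lambda>\<phi>\<in>A0. v \<phi> * w \<phi> - 1) \<in> N_ideal"
  obtains q and r :: real where "r > 0"
    and "\<And>\<phi>. \<phi> \<in> A q \<Longrightarrow>
      \<forall>\<^sub>F \<epsilon> in at_right 0. norm (v (rescale \<epsilon> \<phi>)) \<ge> diam_supp (rescale \<epsilon> \<phi>) powr r"
proof -
  obtain s where s: "\<And>\<phi> q. \<phi> \<in> A q \<Longrightarrow> s \<le> q \<Longrightarrow> power_bounded w \<phi> (- real s)"
    using E_M_E[OF w] by blast
  obtain q\<^sub>0 where q\<^sub>0: "\<And>\<phi> q. \<phi> \<in> A q \<Longrightarrow> q\<^sub>0 \<le> q \<Longrightarrow>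
      ((\<lambda>\<epsilon>. (\<lambda>\<phi>\<in>A0. v \<phi> * w \<phi> - 1) (rescale \<epsilon> \<phi>)) \<longlongrightarrow> 0) (at_right 0)"
    using N_ideal_tendsto_zero[OF N] by blast
  define r where "r = real s + 1"
  have "\<forall>\<^sub>F \<epsilon> in at_right 0. norm (v (rescale \<epsilon> \<phi>)) \<ge> diam_supp (rescale \<epsilon> \<phi>) powr r"
    if \<phi>: "\<phi> \<in> A (max s q\<^sub>0)" for \<phi>
  proof -
    have \<phi>0: "\<phi> \<in> A0" using \<phi> A_subset_A0 by blast
    define d where "d = diam_supp \<phi>"
    have d: "d > 0" unfolding d_def by (rule diam_supp_pos[OF \<phi>0])
    obtain C where C: "C > 0"
      "\<forall>\<^sub>F \<epsilon> in at_right 0. norm (w (rescale \<epsilon> \<phi>)) \<le> C * \<epsilon> powr (- real s)"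
      using s[OF \<phi>] unfolding power_bounded_iff_eventually by auto
    have small: "\<forall>\<^sub>F \<epsilon> in at_right 0. norm ((\<lambda>\<phi>\<in>A0. v \<phi> * w \<phi> - 1) (rescale \<epsilon> \<phi>)) < 1 / 2"
      using tendstoD[OF q\<^sub>0[OF \<phi>], of "1 / 2"] by simp
    have pos: "\<forall>\<^sub>F \<epsilon> in at_right 0. (\<epsilon>::real) > 0"
      by (rule eventually_at_right_less)
    have absorb: "\<forall>\<^sub>F \<epsilon> in at_right 0. (\<epsilon>::real) < 1 / (2 * C * d powr r)"
      unfolding eventually_at_right_field
      using C(1) d by (intro exI[of _ "1 / (2 * C * d powr r)"]) auto
    show ?thesis
      using C(2) small pos absorb
    proof eventually_elim
      case (elim \<epsilon>)
      define a where "a = v (rescale \<epsilon> \<phi>)"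
      define b where "b = w (rescale \<epsilon> \<phi>)"
      have e: "norm (a * b - 1) < 1 / 2"
        using elim by (simp add: a_def b_def rescale_in_A0 \<phi>0)
      have "norm (1 :: 'k) \<le> norm (1 - a * b) + norm (a * b)"
        using norm_triangle_ineq[of "1 - a * b" "a * b"] by simp
      then have "1 / 2 \<le> norm a * norm b"
        using e by (simp add: norm_minus_commute norm_mult)
      also have "\<dots> \<le> norm a * (C * \<epsilon> powr (- real s))"
        using elim by (intro mult_left_mono) (auto simp: b_def)
      finally have "\<epsilon> powr real s \<le> 2 * C * norm a"
        using elim by (simp add: powr_minus field_simps)
      moreover have "2 * C * ((\<epsilon> * d) powr r) \<le> \<epsilon> powr real s"
      proof -
        have "2 * C * ((\<epsilon> * d) powr r) = (2 * C * d powr r * \<epsilon>) * \<epsilon> powr real s"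
          using elim d by (simp add: powr_mult r_def powr_add)
        also have "\<dots> \<le> 1 * \<epsilon> powr real s"
          using elim C(1) d by (intro mult_right_mono) (auto simp: field_simps)
        finally show ?thesis by simp
      qed
      ultimately have "2 * C * ((\<epsilon> * d) powr r) \<le> 2 * C * norm a" by linarith
      then have "(\<epsilon> * d) powr r \<le> norm a" using C(1) by simp
      then show ?case
        using elim by (simp add: a_def d_def diam_supp_rescale \<phi>0)
    qed
  qed
  moreover have "r > 0" by (simp add: r_def)
  ultimately show ?thesis using that by blast
qed

text \<open>
  Off \<open>A q\<close> the function is set to \<open>1\<close>, which dominates \<open>i(\<phi>\<^sub>\<epsilon>)\<^sup>r\<close> for small \<open>\<epsilon>\<close>. Because
  \<open>A q\<close> and its complement are stable under rescaling, each \<open>\<phi>\<close> meets only one of the two cases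
  along all its rescalings.
\<close>

lemma lower_bound_extend:
  fixes v :: "(real \<Rightarrow> real) \<Rightarrow> 'k::real_normed_field"
  assumes v: "v \<in> E_M" and r: "r > 0"
    and lower: "\<And>\<phi>. \<phi> \<in> A q \<Longrightarrow>
      \<forall>\<^sub>F \<epsilon> in at_right 0. norm (v (rescale \<epsilon> \<phi>)) \<ge> diam_supp (rescale \<epsilon> \<phi>) powr r"
  obtains v' where "is_representative v' (N_ideal +>\<^bsub>E_ring\<^esub> v)"
    and "\<And>\<phi>. \<phi> \<in> A0 \<Longrightarrow>
      \<forall>\<^sub>F \<epsilon> in at_right 0. norm (v' (rescale \<epsilon> \<phi>)) \<ge> diam_supp (rescale \<epsilon> \<phi>) powr r"
proof
  define v' where "v' = (\<lambda>\<phi>\<in>A0. if \<phi> \<in> A q then v \<phi> else 1)"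
  have pos: "\<forall>\<^sub>F \<epsilon> in at_right 0. (\<epsilon>::real) > 0"
    by (rule eventually_at_right_less)
  have diff: "(\<lambda>\<phi>\<in>A0. v' \<phi> - v \<phi>) \<in> N_ideal"
  proof (rule eventually_zero_imp_N_ideal)
    fix \<phi> assume \<phi>: "\<phi> \<in> A q"
    show "\<forall>\<^sub>F \<epsilon> in at_right 0. (\<lambda>\<phi>\<in>A0. v' \<phi> - v \<phi>) (rescale \<epsilon> \<phi>) = 0"
      using pos
    proof eventually_elim
      case (elim \<epsilon>)
      then have "rescale \<epsilon> \<phi> \<in> A q" using \<phi> by (simp add: rescale_in_A)
      then show ?case using A_subset_A0[of q] by (auto simp: v'_def)
    qed
  qed simp
  then have "(\<lambda>\<phi>\<in>A0. v' \<phi> - v \<phi>) \<in> E_M"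
    by (simp add: N_ideal_def)
  then have "(\<lambda>\<phi>\<in>A0. (\<lambda>\<phi>\<in>A0. v' \<phi> - v \<phi>) \<phi> + v \<phi>) \<in> E_M"
    using v by (rule E_M_add)
  moreover have "(\<lambda>\<phi>\<in>A0. (\<lambda>\<phi>\<in>A0. v' \<phi> - v \<phi>) \<phi> + v \<phi>) = v'"
    by (auto simp: v'_def fun_eq_iff)
  ultimately have "v' \<in> E_M" by simp
  with diff show "is_representative v' (N_ideal +>\<^bsub>E_ring\<^esub> v)"
    unfolding is_representative_def by (simp add: coset_eq_iff v)
  fix \<phi> :: "real \<Rightarrow> real" assume \<phi>: "\<phi> \<in> A0"
  show "\<forall>\<^sub>F \<epsilon> in at_right 0. norm (v' (rescale \<epsilon> \<phi>)) \<ge> diam_supp (rescale \<epsilon> \<phi>) powr r"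
  proof (cases "\<phi> \<in> A q")
    case True
    from lower[OF True] pos show ?thesis
      by eventually_elim (simp add: v'_def rescale_in_A0 \<phi> rescale_in_A True)
  next
    case False
    have d: "diam_supp \<phi> > 0" by (rule diam_supp_pos[OF \<phi>])
    then have "\<forall>\<^sub>F \<epsilon> in at_right 0. (\<epsilon>::real) < 1 / diam_supp \<phi>"
      unfolding eventually_at_right_field by (intro exI[of _ "1 / diam_supp \<phi>"]) auto
    with pos show ?thesis
    proof eventually_elim
      case (elim \<epsilon>)
      have "diam_supp (rescale \<epsilon> \<phi>) powr r \<le> 1 powr r"
        using elim d r by (intro powr_mono2) (auto simp: diam_supp_rescale \<phi> field_simps)
      then show ?case
        using elim False by (simp add: v'_def rescale_in_A0 \<phi> rescale_in_A_iff)
    qed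
  qed
qed

text \<open>
  The threshold function \<open>\<tau>\<close> is a choice, for each \<open>\<phi>\<close>, of how small \<open>\<epsilon>\<close> has to be; it may
  be cut off at \<open>1\<close>.
\<close>

lemma ex_threshold_iff:
  "(\<exists>\<tau> \<in> S \<rightarrow> {0<..1::real}. \<forall>\<phi>\<in>S. \<forall>\<epsilon>. 0 < \<epsilon> \<and> \<epsilon> < \<tau> \<phi> \<longrightarrow> P \<phi> \<epsilon>) \<longleftrightarrow>
    (\<forall>\<phi>\<in>S. \<forall>\<^sub>F \<epsilon> in at_right 0. P \<phi> \<epsilon>)"
proof
  assume "\<exists>\<tau> \<in> S \<rightarrow> {0<..1::real}. \<forall>\<phi>\<in>S. \<forall>\<epsilon>. 0 < \<epsilon> \<and> \<epsilon> < \<tau> \<phi> \<longrightarrow> P \<phi> \<epsilon>"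
  then show "\<forall>\<phi>\<in>S. \<forall>\<^sub>F \<epsilon> in at_right 0. P \<phi> \<epsilon>"
    unfolding eventually_at_right_field by (metis PiE greaterThanAtMost_iff)
next
  assume "\<forall>\<phi>\<in>S. \<forall>\<^sub>F \<epsilon> in at_right 0. P \<phi> \<epsilon>"
  then have "\<forall>\<phi>\<in>S. \<exists>b>0. \<forall>\<epsilon>>0. \<epsilon> < b \<longrightarrow> P \<phi> \<epsilon>"
    unfolding eventually_at_right_field .
  then obtain b where "\<forall>\<phi>\<in>S. b \<phi> > 0 \<and> (\<forall>\<epsilon>>0. \<epsilon> < b \<phi> \<longrightarrow> P \<phi> \<epsilon>)"
    by metis
  then show "\<exists>\<tau> \<in> S \<rightarrow> {0<..1::real}. \<forall>\<phi>\<in>S. \<forall>\<epsilon>. 0 < \<epsilon> \<and> \<epsilon> < \<tau> \<phi> \<longrightarrow> P \<phi> \<epsilon>"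
    by (intro bexI[of _ "\<lambda>\<phi>. min 1 (b \<phi>)"]) auto
qed

theorem Units_K_f_iff:
  fixes x :: "((real \<Rightarrow> real) \<Rightarrow> 'k::real_normed_field) set"
  assumes x: "x \<in> carrier K_f"
  shows "x \<in> Units K_f \<longleftrightarrow>
      (\<exists>r>0. \<exists>\<tau> \<in> A0 \<rightarrow> {0<..1::real}. \<exists>v. is_representative v x \<and>
        (\<forall>\<phi>\<in>A0. \<forall>\<epsilon>. 0 < \<epsilon> \<and> \<epsilon> < \<tau> \<phi> \<longrightarrow>
          norm (v (rescale \<epsilon> \<phi>)) \<ge> diam_supp (rescale \<epsilon> \<phi>) powr r))"
    (is "_ \<longleftrightarrow> ?lower")
proof -
  have lower_iff: "?lower \<longleftrightarrow> (\<exists>r>0. \<exists>v. is_representative v x \<and>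
      (\<forall>\<phi>\<in>A0. \<forall>\<^sub>F \<epsilon> in at_right 0. norm (v (rescale \<epsilon> \<phi>)) \<ge> diam_supp (rescale \<epsilon> \<phi>) powr r))"
    unfolding ex_threshold_iff[symmetric] by blast
  show ?thesis
  proof
    assume unit: "x \<in> Units K_f"
    obtain u where u: "u \<in> E_M" "x = N_ideal +>\<^bsub>E_ring\<^esub> u"
      using x by (auto simp: carrier_K_f)
    obtain w where w: "w \<in> E_M" "(\<lambda>\<phi>\<in>A0. u \<phi> * w \<phi> - 1) \<in> N_ideal"
      using unit u by (auto simp: coset_in_Units_iff)
    obtain q and r :: real where qr: "r > 0" "\<And>\<phi>. \<phi> \<in> A q \<Longrightarrow>
        \<forall>\<^sub>F \<epsilon> in at_right 0. norm (u (rescale \<epsilon> \<phi>)) \<ge> diam_supp (rescale \<epsilon> \<phi>) powr r"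
      using inverse_imp_lower_bound[OF w] by blast
    obtain v where "is_representative v x" "\<And>\<phi>. \<phi> \<in> A0 \<Longrightarrow>
        \<forall>\<^sub>F \<epsilon> in at_right 0. norm (v (rescale \<epsilon> \<phi>)) \<ge> diam_supp (rescale \<epsilon> \<phi>) powr r"
      using lower_bound_extend[OF u(1) qr] u(2) by blast
    with qr(1) show ?lower
      unfolding lower_iff by blast
  next
    assume ?lower
    then obtain r v where r: "r > 0" and v: "is_representative v x"
      and lower: "\<And>\<phi>. \<phi> \<in> A0 \<Longrightarrow>
        \<forall>\<^sub>F \<epsilon> in at_right 0. norm (v (rescale \<epsilon> \<phi>)) \<ge> diam_supp (rescale \<epsilon> \<phi>) powr r"
      unfolding lower_iff by blast
    have "v \<in> E_M" "x = N_ideal +>\<^bsub>E_ring\<^esub> v"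
      using v by (auto simp: is_representative_def)
    then show "x \<in> Units K_f"
      using lower_bound_imp_inverse[OF r lower] by (simp add: coset_in_Units_iff)
  qed
qed

theorem theorem3p19:
  shows "(\<forall>x \<in> carrier (K_f :: ((real \<Rightarrow> real) \<Rightarrow> real) set ring).
      x \<in> Units K_f \<longleftrightarrow>
      (\<exists>r>0. \<exists>\<tau> \<in> A0 \<rightarrow> {0<..1::real}. \<exists>v. is_representative v x \<and>
        (\<forall>\<phi>\<in>A0. \<forall>\<epsilon>. 0 < \<epsilon> \<and> \<epsilon> < \<tau> \<phi> \<longrightarrow>
          norm (v (rescale \<epsilon> \<phi>)) \<ge> diam_supp (rescale \<epsilon> \<phi>) powr r))) \<and>
    (\<forall>x \<in> carrier (K_f :: ((real \<Rightarrow> real) \<Rightarrow> complex) set ring).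
      x \<in> Units K_f \<longleftrightarrow>
      (\<exists>r>0. \<exists>\<tau> \<in> A0 \<rightarrow> {0<..1::real}. \<exists>v. is_representative v x \<and>
        (\<forall>\<phi>\<in>A0. \<forall>\<epsilon>. 0 < \<epsilon> \<and> \<epsilon> < \<tau> \<phi> \<longrightarrow>
          norm (v (rescale \<epsilon> \<phi>)) \<ge> diam_supp (rescale \<epsilon> \<phi>) powr r)))"
  by (intro conjI ballI Units_K_f_iff)

end
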